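(* Let $(m,n,k)\in\mathbb{Z}^3$ be such that $k^2-4mn>0$ is not a perfect square. The period $\Gamma(m,n,k)$ is palindromic and odd if and only if the class $C(m,n,k)$ is supersymmetric.
   Context: The triple $\mathbf f=(m,n,k)\in\mathbb{Z}^3$ denotes the binary quadratic form $f(x,y)=mx^2+ny^2+kxy$. The class $C(\mathbf f)=C(m,n,k)$ is the orbit of $\mathbf f$ under the action of $\mathrm{SL}(2,\mathbb{Z})$ by linear changes of the variables $(x,y)$. For $\mathbf f=(m,n,k)$ define the conjugate $\overline{\mathbf f}=(m,n,-k)$, the adjoint $\mathbf f^*=(-n,-m,k)$ and the antipodal $\overline{\mathbf f}^*=(-n,-m,-k)$. If a class contains one form together with its image under one of these involutions, the whole class is invariant under that involution. A class is called supersymmetric if it is invariant under the conjugation and under the adjoint involution (and thus also under the antipodal involution). For $k^2-4mn>0$ not a perfect square, put $\xi^{+}(\mathbf f)=\frac{-k+\sqrt{k^2-4mn}}{2m}$; its (regular) continued fraction is eventually periodic (the continued fraction of a negative number $\xi$ is written $-[\alpha_0,\alpha_1,\dots]$, where $[\alpha_0,\alpha_1,\dots]$ is that of $|\xi|$). $\Gamma(m,n,k)$ denotes its period, i.e. its minimal repeating block of positive integers, considered up to cyclic permutation. A period is even (odd) if its length is even (odd). A period is palindromic if some cyclic permutation of it is equal to the same sequence written backwards. *)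

theory Defs
  imports Complex_Main
begin

section \<open>Binary quadratic forms and their classes\<close>

text \<open>The triple \<open>(m, n, k)\<close> stands for the form \<open>m x^2 + n y^2 + k x y\<close>:
  the coefficient of the mixed term comes last.\<close>

type_synonym form = "int \<times> int \<times> int"

fun form_value :: "form \<Rightarrow> int \<Rightarrow> int \<Rightarrow> int" where
  "form_value (m, n, k) x y = m * x\<^sup>2 + n * y\<^sup>2 + k * x * y"

fun form_disc :: "form \<Rightarrow> int" where
  "form_disc (m, n, k) = k\<^sup>2 - 4 * m * n"

text \<open>An integral form is determined by its values on integral vectors, so that the condition
  below says that \<open>g\<close> arises from \<open>f\<close> by a change of variables in \<open>SL(2, Z)\<close>.\<close>

definition form_class :: "form \<Rightarrow> form set" where
  "form_class f = {g. \<exists>a b c d :: int. a * d - b * c = 1 \<and>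
     (\<forall>x y. form_value g x y = form_value f (a * x + b * y) (c * x + d * y))}"

lemma form_value_inject:
  assumes "\<And>x y. form_value f x y = form_value g x y"
  shows "f = g"
  using assms[of 1 0] assms[of 0 1] assms[of 1 1] by (cases f; cases g) auto

fun conjugate :: "form \<Rightarrow> form" where
  "conjugate (m, n, k) = (m, n, - k)"

fun adjoint :: "form \<Rightarrow> form" where
  "adjoint (m, n, k) = (- n, - m, k)"

definition supersymmetric :: "form set \<Rightarrow> bool" where
  "supersymmetric C \<longleftrightarrow> conjugate ` C = C \<and> adjoint ` C = C"

section \<open>Continued fractions and their periods\<close>

primrec complete_quotient :: "real \<Rightarrow> nat \<Rightarrow> real" where
  "complete_quotient x 0 = x"
| "complete_quotient x (Suc i) = 1 / frac (complete_quotient x i)"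

text \<open>The continued fraction of a negative number \<open>x\<close> is \<open>- [a 0, a 1, ...]\<close>, where
  \<open>[a 0, a 1, ...]\<close> is that of \<open>\<bar>x\<bar>\<close>. We only use it for irrational \<open>x\<close>, where it never stops.\<close>

definition cf_elements :: "real \<Rightarrow> nat \<Rightarrow> int" where
  "cf_elements x i = \<lfloor>complete_quotient \<bar>x\<bar> i\<rfloor>"

definition repeating_block :: "(nat \<Rightarrow> 'a) \<Rightarrow> 'a list \<Rightarrow> bool" where
  "repeating_block a B \<longleftrightarrow> B \<noteq> [] \<and> (\<exists>N. \<forall>i. a (N + i) = B ! (i mod length B))"

text \<open>The period, considered up to cyclic permutation, is the set of all minimal repeating
  blocks; by \<open>period_eq_rotations\<close> these are exactly the cyclic permutations of any one of them.\<close>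

definition period :: "(nat \<Rightarrow> 'a) \<Rightarrow> 'a list set" where
  "period a = {B. repeating_block a B \<and> (\<forall>B'. repeating_block a B' \<longrightarrow> length B \<le> length B')}"

lemma repeating_block_rotate:
  assumes "repeating_block a B"
  shows "repeating_block a (rotate j B)"
proof -
  obtain N where N: "\<And>i. a (N + i) = B ! (i mod length B)" and ne: "B \<noteq> []"
    using assms by (auto simp: repeating_block_def)
  have "a ((N + j) + i) = rotate j B ! (i mod length (rotate j B))" for i
    using N[of "j + i"] ne by (simp add: nth_rotate add.assoc mod_add_right_eq)
  with ne show ?thesis
    unfolding repeating_block_def by (metis rotate_is_Nil_conv)
qed

lemma period_eq_rotations:
  assumes B: "B \<in> period a"
  shows "period a = {rotate j B | j. True}"
proof (intro equalityI subsetI)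
  fix B' assume B': "B' \<in> period a"
  have len: "length B' = length B"
    using B B' unfolding period_def by (auto intro: antisym)
  obtain N where N: "\<And>i. a (N + i) = B ! (i mod length B)" and ne: "B \<noteq> []"
    using B by (auto simp: period_def repeating_block_def)
  obtain N' where N': "\<And>i. a (N' + i) = B' ! (i mod length B')"
    using B' by (auto simp: period_def repeating_block_def)
  have "rotate N' B = rotate N B'"
  proof (rule nth_equalityI)
    fix i assume "i < length (rotate N' B)"
    then show "rotate N' B ! i = rotate N B' ! i"
      using N[of "N' + i"] N'[of "N + i"] len by (simp add: nth_rotate ac_simps)
  qed (simp add: len)
  moreover obtain q where q: "(q + N) mod length B = 0"
  proof
    show "(N * (length B - 1) + N) mod length B = 0"
    proof -
      have "N * (length B - 1) + N = N * length B"
        using ne by (cases B) auto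
      then show ?thesis by simp
    qed
  qed
  ultimately have "rotate (q + N') B = B'"
    by (metis len rotate_rotate rotate_id)
  then show "B' \<in> {rotate j B | j. True}" by blast
next
  fix B' assume "B' \<in> {rotate j B | j. True}"
  then show "B' \<in> period a"
    using B repeating_block_rotate unfolding period_def by fastforce
qed

definition odd_period :: "'a list set \<Rightarrow> bool" where
  "odd_period P \<longleftrightarrow> (\<exists>B\<in>P. odd (length B))"

definition palindromic_period :: "'a list set \<Rightarrow> bool" where
  "palindromic_period P \<longleftrightarrow> (\<exists>B\<in>P. \<exists>j. rotate j B = rev B)"

fun xi_plus :: "form \<Rightarrow> real" where
  "xi_plus (m, n, k) = (- of_int k + sqrt (of_int (k\<^sup>2 - 4 * m * n))) / (2 * of_int m)"

definition form_period :: "form \<Rightarrow> int list set" where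
  "form_period f = period (cf_elements (xi_plus f))"

end

theory Submission
  imports Defs
begin

text \<open>
  Why the theorem holds. Let \<open>x\<close> be the root of the form \<open>f\<close> and \<open>x'\<close> its algebraic conjugate.
  Among forms of a fixed nonsquare discriminant, a form is determined by its root, and proper
  equivalence of forms is equivalence of their roots under integral fractional linear maps of
  determinant \<open>1\<close> (\<open>form_class_iff_moebius_related\<close>). The conjugate form has the root \<open>- x'\<close> and the
  adjoint form the root \<open>- 1 / x'\<close>. As \<open>t \<mapsto> - t\<close> has determinant \<open>- 1\<close> and \<open>t \<mapsto> - 1 / t\<close> has
  determinant \<open>1\<close>, the class is invariant under conjugation if and only if \<open>x\<close> and \<open>x'\<close> are related
  with determinant \<open>- 1\<close>, and under the adjoint involution if and only if they are related with
  determinant \<open>1\<close>. Both hold together exactly when \<open>x\<close> is related to itself with determinant \<open>- 1\<close>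
  and to \<open>x'\<close> with some determinant (\<open>supersymmetric_iff_moebius_related\<close>).

  These two conditions are the two properties of the period. By Serret's theorem, numbers related
  with determinant \<open>e\<close> are those whose continued fractions have a common tail after removal of
  \<open>i\<close> and \<open>j\<close> elements with \<open>e = (- 1) ^ (i + j)\<close>. Applied to \<open>x\<close> and itself, determinant \<open>- 1\<close>
  means an odd shift of the sequence of elements, that is, an odd period, since the length of the
  period divides every eventual shift (\<open>length_period_dvd\<close>). By Galois' theorem, the continued
  fraction of \<open>- 1 / y'\<close>, for a late complete quotient \<open>y\<close> of \<open>x\<close>, repeats the period of \<open>x\<close>
  backwards (\<open>galois_reversed_period\<close>). Hence \<open>x\<close> and \<open>x'\<close> are related if and only if the period
  and its reversal generate sequences with a common tail, that is, the period is palindromic.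
\<close>

section \<open>Unimodular equivalence of real numbers\<close>

text \<open>The equation \<open>x = (a y + b) / (c y + d)\<close> is multiplied out, so that composition and inversion
  are plain matrix algebra, whatever the denominators. The determinant \<open>e\<close> is part of the relation: only
  its values \<open>1\<close> and \<open>- 1\<close> are of interest, and distinguishing them is what separates odd from
  even periods, and the conjugate of a form from its adjoint.\<close>

definition moebius_related :: "int \<Rightarrow> real \<Rightarrow> real \<Rightarrow> bool" where
  "moebius_related e x y \<longleftrightarrow> (\<exists>a b c d :: int. a * d - b * c = e \<and>
     x * (of_int c * y + of_int d) = of_int a * y + of_int b)"

lemma moebius_relatedI:
  assumes "a * d - b * c = e"
    and "x * (of_int c * y + of_int d) = of_int a * y + of_int b"
  shows "moebius_related e x y"
  using assms unfolding moebius_related_def by blast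

lemma moebius_related_trans:
  assumes "moebius_related e x y" "moebius_related e' y z"
  shows "moebius_related (e * e') x z"
proof -
  obtain a b c d where 1: "a * d - b * c = e"
      "x * (of_int c * y + of_int d) = of_int a * y + of_int b"
    using assms(1) unfolding moebius_related_def by blast
  obtain a' b' c' d' where 2: "a' * d' - b' * c' = e'"
      "y * (of_int c' * z + of_int d') = of_int a' * z + of_int b'"
    using assms(2) unfolding moebius_related_def by blast
  have "(a * a' + b * c') * (c * b' + d * d') - (a * b' + b * d') * (c * a' + d * c') = e * e'"
    unfolding 1(1)[symmetric] 2(1)[symmetric] by (simp add: algebra_simps)
  moreover have "x * (of_int (c * a' + d * c') * z + of_int (c * b' + d * d'))
      = of_int (a * a' + b * c') * z + of_int (a * b' + b * d')"
  proof -
    have "x * (of_int (c * a' + d * c') * z + of_int (c * b' + d * d'))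
        = x * (of_int c * (of_int a' * z + of_int b') + of_int d * (of_int c' * z + of_int d'))"
      by (simp add: algebra_simps)
    also have "\<dots> = x * (of_int c * y + of_int d) * (of_int c' * z + of_int d')"
      unfolding 2(2)[symmetric] by (simp add: algebra_simps)
    also have "\<dots> = of_int a * (y * (of_int c' * z + of_int d')) + of_int b * (of_int c' * z + of_int d')"
      unfolding 1(2) by (simp add: algebra_simps)
    also have "\<dots> = of_int (a * a' + b * c') * z + of_int (a * b' + b * d')"
      unfolding 2(2) by (simp add: algebra_simps)
    finally show ?thesis .
  qed
  ultimately show ?thesis by (rule moebius_relatedI)
qed

lemma moebius_related_sym:
  assumes "moebius_related e x y"
  shows "moebius_related e y x"
proof -
  obtain a b c d where 1: "a * d - b * c = e"
      "x * (of_int c * y + of_int d) = of_int a * y + of_int b"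
    using assms(1) unfolding moebius_related_def by blast
  show ?thesis
    using 1 by (intro moebius_relatedI[of "- d" "- a" b c]) (auto simp: algebra_simps)
qed

lemma moebius_related_uminus: "moebius_related (- 1) x (- x)"
  by (rule moebius_relatedI[of "-1" 1 0 0]) auto

lemma moebius_related_uminus_iff: "moebius_related e (- x) (- y) \<longleftrightarrow> moebius_related e x y"
proof -
  have "moebius_related e (- x) (- y)" if "moebius_related e x y" for x y
    using moebius_related_trans[OF moebius_related_trans[OF
        moebius_related_sym[OF moebius_related_uminus] that] moebius_related_uminus] by simp
  from this[of x y] this[of "- x" "- y"] show ?thesis by auto
qed

lemma moebius_related_uminus_inverse: "x \<noteq> 0 \<Longrightarrow> moebius_related 1 x (- 1 / x)"
  by (rule moebius_relatedI[of 0 0 "-1" 1]) auto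

lemma moebius_related_inverse_diff:
  assumes "x \<noteq> of_int n"
  shows "moebius_related (- 1) x (1 / (x - of_int n))"
  by (rule moebius_relatedI[of n 0 1 1]) (use assms in \<open>auto simp: divide_simps\<close>)

section \<open>Complete quotients\<close>

lemma complete_quotient_add:
  "complete_quotient x (i + j) = complete_quotient (complete_quotient x i) j"
  by (induction j) auto

lemma complete_quotient_Suc_floor:
  "complete_quotient x (Suc i) = 1 / (complete_quotient x i - of_int \<lfloor>complete_quotient x i\<rfloor>)"
  by (simp add: frac_def)

lemma irrational_inverse: "(x::real) \<notin> \<rat> \<Longrightarrow> 1 / x \<notin> \<rat>"
  using Rats_divide[of 1 "1 / x"] by auto

lemma irrational_diff_int: "(x::real) \<notin> \<rat> \<Longrightarrow> x - of_int n \<notin> \<rat>"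
  using Rats_add[of "x - of_int n" "of_int n"] by auto

lemma irrational_uminus: "(x::real) \<notin> \<rat> \<Longrightarrow> - x \<notin> \<rat>"
  by simp

lemma complete_quotient_irrational: "x \<notin> \<rat> \<Longrightarrow> complete_quotient x i \<notin> \<rat>"
  by (induction i) (simp_all add: frac_def irrational_inverse irrational_diff_int)

lemma irrational_frac: "(x::real) \<notin> \<rat> \<Longrightarrow> 0 < frac x"
  by (metis frac_gt_0_iff Ints_subset_Rats subsetD)

lemma complete_quotient_gt_1:
  assumes "x \<notin> \<rat>"
  shows "1 < complete_quotient x (Suc i)"
  using irrational_frac[OF complete_quotient_irrational[OF assms, of i]] frac_lt_1 by simp

lemma floor_complete_quotient_ge_1:
  assumes "x \<notin> \<rat>" "i > 0"
  shows "\<lfloor>complete_quotient x i\<rfloor> \<ge> 1"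
proof -
  have "1 < complete_quotient x i"
    using complete_quotient_gt_1[OF assms(1)] assms(2) gr0_implies_Suc by blast
  then show ?thesis by simp
qed

text \<open>One step of the algorithm, \<open>x = a + 1 / y\<close>, is a transformation of determinant \<open>- 1\<close>.\<close>

lemma moebius_related_complete_quotient:
  assumes "x \<notin> \<rat>"
  shows "moebius_related ((- 1) ^ i) x (complete_quotient x i)"
proof (induction i)
  case 0
  show ?case by (rule moebius_relatedI[of 1 1 0 0]) auto
next
  case (Suc i)
  have "complete_quotient x i \<noteq> of_int \<lfloor>complete_quotient x i\<rfloor>"
    using complete_quotient_irrational[OF assms, of i] by (metis Rats_of_int)
  from moebius_related_trans[OF Suc moebius_related_inverse_diff[OF this]]
  show ?case by (simp add: frac_def)
qed

text \<open>If the elements agree, then \<open>x - y = 1 / x1 - 1 / y1\<close> for the next complete quotients, so that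
  \<open>\<bar>x - y\<bar> x1 y1 = \<bar>x1 - y1\<bar>\<close>. Two successive complete quotients have product above \<open>2\<close>, hence every
  two steps gain a factor \<open>4\<close>, while complete quotients with equal integer part stay within
  distance \<open>1\<close>.\<close>

lemma complete_quotient_unique:
  assumes "x \<notin> \<rat>" "y \<notin> \<rat>"
    and "\<And>i. \<lfloor>complete_quotient x i\<rfloor> = \<lfloor>complete_quotient y i\<rfloor>"
  shows "x = y"
proof -
  have bound: "\<bar>x - y\<bar> \<le> 1 / 4 ^ k"
    if "x \<notin> \<rat>" "y \<notin> \<rat>" "\<And>i. \<lfloor>complete_quotient x i\<rfloor> = \<lfloor>complete_quotient y i\<rfloor>" for k x y
    using that
  proof (induction k arbitrary: x y)
    case 0
    show ?case using 0(3)[of 0] by simp linarith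
  next
    case (Suc k)
    let ?x = "complete_quotient x" and ?y = "complete_quotient y"
    have step: "\<bar>?x i - ?y i\<bar> * (?x (Suc i) * ?y (Suc i)) = \<bar>?x (Suc i) - ?y (Suc i)\<bar>" for i
    proof -
      have p: "?x (Suc i) > 0" "?y (Suc i) > 0"
        using complete_quotient_gt_1[OF Suc.prems(1), of i] complete_quotient_gt_1[OF Suc.prems(2), of i]
        by linarith+
      have "?x i = of_int \<lfloor>?x i\<rfloor> + 1 / ?x (Suc i)" "?y i = of_int \<lfloor>?x i\<rfloor> + 1 / ?y (Suc i)"
        by (simp_all add: frac_def Suc.prems(3))
      then have "?x i - ?y i = 1 / ?x (Suc i) - 1 / ?y (Suc i)"
        by linarith
      then have "(?x i - ?y i) * (?x (Suc i) * ?y (Suc i)) = ?y (Suc i) - ?x (Suc i)"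
        using p by (simp add: field_simps)
      then have "\<bar>?x i - ?y i\<bar> * \<bar>?x (Suc i) * ?y (Suc i)\<bar> = \<bar>?y (Suc i) - ?x (Suc i)\<bar>"
        by (metis abs_mult)
      then show ?thesis using p by simp
    qed
    have two: "2 < complete_quotient z 1 * complete_quotient z 2" if "z \<notin> \<rat>" for z
    proof -
      let ?z = "complete_quotient z"
      have g: "?z 1 > 1" "?z 2 > 1"
        using complete_quotient_gt_1[OF that, of 0] complete_quotient_gt_1[OF that, of 1]
        by (simp_all add: numeral_2_eq_2)
      have "?z 1 = of_int \<lfloor>?z 1\<rfloor> + 1 / ?z 2"
        by (simp add: numeral_2_eq_2 frac_def)
      then have "?z 1 * ?z 2 = of_int \<lfloor>?z 1\<rfloor> * ?z 2 + 1"
        using g by (simp add: field_simps)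
      moreover have "1 * ?z 2 \<le> of_int \<lfloor>?z 1\<rfloor> * ?z 2"
        using g by (intro mult_right_mono) auto
      ultimately show ?thesis using g by linarith
    qed
    have "\<bar>x - y\<bar> * 4 \<le> \<bar>x - y\<bar> * ((?x 1 * ?x 2) * (?y 1 * ?y 2))"
      using mult_strict_mono[OF two[OF Suc.prems(1)] two[OF Suc.prems(2)]] two[OF Suc.prems(1)]
      by (intro mult_left_mono) auto
    also have "\<dots> = (\<bar>?x 0 - ?y 0\<bar> * (?x (Suc 0) * ?y (Suc 0))) * (?x (Suc 1) * ?y (Suc 1))"
      by (simp only: complete_quotient.simps(1) numeral_2_eq_2 One_nat_def mult_ac)
    also have "\<dots> = \<bar>?x 2 - ?y 2\<bar>"
      unfolding step[of 0] using step[of 1]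
      by (simp only: numeral_2_eq_2 One_nat_def)
    also have "\<dots> \<le> 1 / 4 ^ k"
    proof (rule Suc.IH)
      show "\<lfloor>complete_quotient (?x 2) i\<rfloor> = \<lfloor>complete_quotient (?y 2) i\<rfloor>" for i
        using Suc.prems(3)[of "2 + i"] by (simp only: complete_quotient_add)
    qed (simp_all only: complete_quotient_irrational Suc.prems not_False_eq_True)
    finally show ?case by simp
  qed
  have "\<bar>x - y\<bar> \<le> 0"
  proof (rule LIMSEQ_le_const)
    show "(\<lambda>k. 1 / 4 ^ k :: real) \<longlonglongrightarrow> 0"
      using LIMSEQ_realpow_zero[of "1 / 4 :: real"] by (simp add: power_one_over)
  qed (use bound[OF assms] in auto)
  then show ?thesis by simp
qed

section \<open>Serret's theorem, with the determinant\<close>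

text \<open>The continued fractions of \<open>x\<close> and \<open>y\<close> share a tail. The sign \<open>e\<close> records the parity of the
  number of elements removed, which by \<open>moebius_related_complete_quotient\<close> gives the determinant of a
  transformation relating \<open>x\<close> and \<open>y\<close>.\<close>

definition tails_meet :: "int \<Rightarrow> real \<Rightarrow> real \<Rightarrow> bool" where
  "tails_meet e x y \<longleftrightarrow>
     (\<exists>i j. complete_quotient x i = complete_quotient y j \<and> e = (- 1) ^ (i + j))"

lemma tails_meet_imp_moebius_related:
  assumes "tails_meet e x y" "x \<notin> \<rat>" "y \<notin> \<rat>"
  shows "moebius_related e x y"
proof -
  obtain i j where ij: "complete_quotient x i = complete_quotient y j" "e = (- 1) ^ (i + j)"
    using assms(1) unfolding tails_meet_def by blast
  show ?thesis
    using moebius_related_trans[OF moebius_related_complete_quotient[OF assms(2), of i]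
        moebius_related_sym[OF moebius_related_complete_quotient[OF assms(3), of j], folded ij(1)]]
    by (simp add: ij(2) power_add)
qed

lemma tails_meetI:
  "complete_quotient x i = complete_quotient y j \<Longrightarrow> e = (- 1) ^ (i + j) \<Longrightarrow> tails_meet e x y"
  unfolding tails_meet_def by blast

lemma tails_meet_refl: "tails_meet 1 x x"
  by (rule tails_meetI[of _ 0 _ 0]) auto

lemma tails_meet_sym: "tails_meet e x y \<Longrightarrow> tails_meet e y x"
  unfolding tails_meet_def by (metis add.commute)

lemma tails_meet_trans:
  assumes "tails_meet e x y" "tails_meet e' y z"
  shows "tails_meet (e * e') x z"
proof -
  obtain i j where ij: "complete_quotient x i = complete_quotient y j" "e = (- 1) ^ (i + j)"
    using assms(1) unfolding tails_meet_def by blast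
  obtain k l where kl: "complete_quotient y k = complete_quotient z l" "e' = (- 1) ^ (k + l)"
    using assms(2) unfolding tails_meet_def by blast
  have "complete_quotient x (i + k) = complete_quotient z (l + j)"
    using ij(1) kl(1) by (metis complete_quotient_add add.commute)
  then show ?thesis
    by (rule tails_meetI) (simp add: ij kl power_add)
qed

lemma tails_meet_diff_int: "tails_meet 1 x (x - of_int n)"
  by (rule tails_meetI[of _ 1 _ 1]) (auto simp: frac_def)

lemma frac_inverse_gt_1:
  fixes x :: real
  assumes "x > 1"
  shows "frac (1 / x) = 1 / x"
  using assms by (simp add: frac_eq)

text \<open>This is the classical identity \<open>- [a, b, z] = [- a - 1, 1, b - 1, z]\<close>. It lengthens the expansion
  by one element, whence the sign; for \<open>b = 1\<close> the element \<open>b - 1\<close> vanishes and its two neighbours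
  merge, which shortens the expansion by one instead.\<close>

lemma tails_meet_uminus:
  assumes "x \<notin> \<rat>"
  shows "tails_meet (- 1) x (- x)"
proof -
  define y where "y = complete_quotient x 1"
  have y: "y \<notin> \<rat>" "y > 1" "x = of_int \<lfloor>x\<rfloor> + 1 / y"
    using complete_quotient_irrational[OF assms, of 1] complete_quotient_gt_1[OF assms, of 0]
    by (simp_all add: y_def frac_def)
  have *: "complete_quotient (- x) 1 = 1 + 1 / (y - 1)"
  proof -
    have "frac (- x) = 1 - 1 / y"
    proof -
      have "- x - (1 - 1 / y) = of_int (- \<lfloor>x\<rfloor> - 1)"
        using y(3) by simp
      then have "- x - (1 - 1 / y) \<in> \<int>"
        by (metis Ints_of_int)
      then show ?thesis
        using y(2) by (simp add: frac_unique_iff)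
    qed
    then have "complete_quotient (- x) 1 = 1 / (1 - 1 / y)"
      by simp
    also have "\<dots> = 1 + 1 / (y - 1)"
      using y(2) by (simp add: field_simps)
    finally show ?thesis .
  qed
  have frac1: "frac (1 + z) = frac z" "frac (z - 1) = frac z" for z :: real
    by (simp_all add: frac_def algebra_simps)
  have "y \<noteq> 2" using y by auto
  then consider "y > 2" | "y < 2" by linarith
  then show ?thesis
  proof cases
    case 1
    then have "frac (1 + 1 / (y - 1)) = 1 / (y - 1)"
      by (simp only: frac1) (simp add: frac_eq)
    then have "complete_quotient (- x) 2 = y - 1"
      using * by (simp add: numeral_2_eq_2)
    then have "complete_quotient (- x) 3 = complete_quotient x 2"
      by (simp add: eval_nat_numeral y_def frac1)
    then show ?thesis
      by (intro tails_meetI[of _ 2 _ 3]) auto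
  next
    case 2
    have "frac y = y - 1"
      using 2 y(2) by (simp add: frac_unique_iff)
    then have "complete_quotient x 2 = 1 / (y - 1)"
      by (simp add: eval_nat_numeral y_def)
    then have "complete_quotient (- x) 2 = complete_quotient x 3"
      using * by (simp add: eval_nat_numeral frac1)
    then show ?thesis
      by (intro tails_meetI[of _ 3 _ 2]) auto
  qed
qed

text \<open>For positive numbers inversion inserts or removes a leading \<open>0\<close>. Negative ones are reduced to
  these by two changes of sign, which together do not affect the parity.\<close>

lemma tails_meet_inverse:
  assumes "x \<notin> \<rat>"
  shows "tails_meet (- 1) x (1 / x)"
proof -
  have pos: "tails_meet (- 1) y (1 / y)" if "y \<notin> \<rat>" "y > 0" for y
  proof (cases "y > 1")
    case True
    then show ?thesis
      by (intro tails_meetI[of _ 0 _ 1]) (simp_all add: frac_inverse_gt_1)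
  next
    case False
    then have "y < 1" using that by (cases "y = 1") auto
    then have "frac y = y" using that by (simp add: frac_eq)
    then show ?thesis
      by (intro tails_meetI[of _ 1 _ 0]) simp_all
  qed
  show ?thesis
  proof (cases "x > 0")
    case True
    then show ?thesis using pos assms by blast
  next
    case False
    then have "- x > 0" using assms by (cases "x = 0") auto
    then have "tails_meet (- 1) (- x) (1 / (- x))"
      using pos[of "- x"] assms by simp
    from tails_meet_trans[OF tails_meet_trans[OF tails_meet_uminus[OF assms] this]
        tails_meet_uminus[OF irrational_inverse[OF irrational_uminus[OF assms]]]]
    show ?thesis by simp
  qed
qed

text \<open>The hard direction of Serret's theorem. The matrix is
  decomposed by the Euclidean algorithm on its first column into translations, inversions and a
  change of sign, for each of which the claim, including the parity, is known. The induction is on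
  the lower left entry: subtracting \<open>q = a div c\<close> from \<open>x\<close> and inverting replaces it by \<open>a mod c\<close>.\<close>

lemma moebius_related_imp_tails_meet:
  assumes "moebius_related e x y" "e \<in> {1, - 1}" "x \<notin> \<rat>" "y \<notin> \<rat>"
  shows "tails_meet e x y"
proof -
  have "tails_meet e x y"
    if "a * d - b * c = e" "x * (of_int c * y + of_int d) = of_int a * y + of_int b"
      "e \<in> {1, - 1}" "x \<notin> \<rat>" for a b c d e x
    using that
  proof (induction "nat \<bar>c\<bar>" arbitrary: a b c d e x rule: less_induct)
    case less
    show ?case
    proof (cases "c = 0")
      case True
      have ad: "a * d = e" using less.prems True by simp
      then have "\<bar>d * a\<bar> = 1" using less.prems(3) by (auto simp: mult.commute)
      then have "\<bar>d\<bar> = 1" by (rule abs_zmult_eq_1)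
      then have dd: "d * d = 1" by (metis abs_mult_self_eq mult_1)
      have "x = x * of_int (d * d)" using dd by simp
      also have "\<dots> = (of_int a * y + of_int b) * of_int d"
        using less.prems(2) True by simp
      also have "\<dots> = of_int e * y + of_int (b * d)"
        by (simp add: ad[symmetric] algebra_simps)
      finally have x: "x - of_int (b * d) = of_int e * y" by simp
      have 1: "tails_meet 1 x (of_int e * y)"
        using tails_meet_diff_int[of x "b * d"] unfolding x .
      have 2: "tails_meet e (of_int e * y) y"
        using less.prems(3) tails_meet_refl tails_meet_sym[OF tails_meet_uminus[OF assms(4)]] by auto
      show ?thesis
        using tails_meet_trans[OF 1 2] by simp
    next
      case False
      define q r where "q = a div c" and "r = a mod c"
      have a: "a = q * c + r" by (simp add: q_def r_def)
      have lt: "nat \<bar>r\<bar> < nat \<bar>c\<bar>"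
        using False by (simp add: r_def abs_mod_less)
      define z where "z = x - of_int q"
      have z: "z \<notin> \<rat>" using less.prems(4) irrational_diff_int by (simp add: z_def)
      then have z0: "z \<noteq> 0" by auto
      have "z * (of_int c * y + of_int d) = of_int r * y + of_int (b - q * d)"
        using less.prems(2) by (simp add: z_def a algebra_simps)
      then have "1 / z * (of_int r * y + of_int (b - q * d)) = of_int c * y + of_int d"
        using z0 by (simp add: field_simps)
      moreover have "c * (b - q * d) - d * r = - e"
        using less.prems(1) by (simp add: a algebra_simps)
      ultimately have "tails_meet (- e) (1 / z) y"
        using less.hyps[OF lt] less.prems(3) irrational_inverse[OF z] by auto
      from tails_meet_trans[OF tails_meet_trans[OF tails_meet_diff_int[of x q, folded z_def]
            tails_meet_inverse[OF z]] this]
      show ?thesis by simp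
    qed
  qed
  then show ?thesis
    using assms unfolding moebius_related_def by blast
qed

section \<open>Periods of eventually periodic sequences\<close>

lemma repeating_blockI:
  assumes "d > 0" "\<And>i. i \<ge> N \<Longrightarrow> a (i + d) = a i"
  shows "repeating_block a (map (\<lambda>i. a (N + i)) [0..<d])"
proof -
  have "a (N + i) = a (N + i mod d)" for i
  proof (induction i rule: less_induct)
    case (less i)
    show ?case
    proof (cases "i < d")
      case False
      then have "a (N + i) = a (N + (i - d))"
        using assms(2)[of "N + (i - d)"] by simp
      also have "\<dots> = a (N + (i - d) mod d)"
        using False assms(1) by (intro less) auto
      finally show ?thesis
        using False by (simp add: le_mod_geq)
    qed simp
  qed
  then show ?thesis
    using assms(1) unfolding repeating_block_def
    by (auto intro!: exI[of _ N])
qed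

lemma repeating_block_shift:
  assumes "repeating_block a B"
  shows "\<exists>N. \<forall>i\<ge>N. a (i + length B) = a i"
proof -
  obtain N where N: "\<And>i. a (N + i) = B ! (i mod length B)"
    using assms unfolding repeating_block_def by blast
  have "a (i + length B) = a i" if "i \<ge> N" for i
  proof -
    have "a (N + (i - N) + length B) = a (N + (i - N))"
      unfolding add.assoc N by simp
    then show ?thesis using that by simp
  qed
  then show ?thesis by blast
qed

text \<open>Two eventual shifts \<open>r\<close> and \<open>d\<close> of a sequence have \<open>gcd r d\<close> as another one, and the minimal
  one cannot be undercut. In particular a single odd shift forces the period to be odd.\<close>

lemma length_period_dvd:
  assumes B: "B \<in> period a" and d: "\<And>i. i \<ge> N \<Longrightarrow> a (i + d) = a i"
  shows "length B dvd d"
proof -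
  let ?r = "length B"
  have r0: "?r > 0" and block: "repeating_block a B"
    using B by (auto simp: period_def repeating_block_def)
  obtain M where M: "\<And>i. i \<ge> M \<Longrightarrow> a (i + ?r) = a i"
    using repeating_block_shift[OF block] by blast
  have multiple: "a (i + p * t) = a i"
    if "\<And>i. i \<ge> L \<Longrightarrow> a (i + p) = a i" "i \<ge> L" for L p t i
  proof (induction t)
    case (Suc t)
    then show ?case using that(1)[of "i + p * t"] that(2) by (simp add: algebra_simps)
  qed simp
  obtain s t where st: "?r * s = d * t + gcd ?r d"
    using bezout_nat[of ?r d] r0 by auto
  have "a (i + gcd ?r d) = a i" if i: "i \<ge> max M N" for i
  proof -
    have "a (i + gcd ?r d) = a (i + gcd ?r d + d * t)"
      using multiple[of N d "i + gcd ?r d" t] d i by simp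
    also have "\<dots> = a (i + ?r * s)"
      by (simp only: st add_ac)
    also have "\<dots> = a i"
      using multiple[of M ?r i s] M i by simp
    finally show ?thesis .
  qed
  then have "repeating_block a (map (\<lambda>i. a (max M N + i)) [0..<gcd ?r d])"
    using r0 by (intro repeating_blockI) auto
  with B have "?r \<le> gcd ?r d"
    unfolding period_def by force
  then have "gcd ?r d = ?r"
    using r0 by (intro antisym) (auto intro: dvd_imp_le)
  then show ?thesis by (metis gcd_dvd2)
qed

lemma period_nonempty:
  assumes "d > 0" "\<And>i. i \<ge> N \<Longrightarrow> a (i + d) = a i"
  shows "\<exists>B. B \<in> period a"
proof -
  have "\<exists>B. repeating_block a B"
    using repeating_blockI[of d N a] assms by blast
  then show ?thesis
    using ex_has_least_nat[of "repeating_block a" _ length] unfolding period_def by blast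
qed

text \<open>Being palindromic means that the periodic sequences of \<open>B\<close> and of its reversal have a common
  tail.\<close>

lemma rotation_eq_rev_iff:
  assumes "B \<noteq> []"
  shows "(\<exists>j. rotate j B = rev B) \<longleftrightarrow>
    (\<exists>p q. \<forall>i. B ! ((p + i) mod length B) = rev B ! ((q + i) mod length B))"
proof
  assume "\<exists>j. rotate j B = rev B"
  then obtain j where j: "rotate j B = rev B" by blast
  have "B ! ((j + i) mod length B) = rev B ! ((0 + i) mod length B)" for i
    using assms unfolding j[symmetric] by (simp add: nth_rotate mod_add_right_eq)
  then show "\<exists>p q. \<forall>i. B ! ((p + i) mod length B) = rev B ! ((q + i) mod length B)"
    by blast
next
  assume "\<exists>p q. \<forall>i. B ! ((p + i) mod length B) = rev B ! ((q + i) mod length B)"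
  then obtain p q where pq: "\<And>i. B ! ((p + i) mod length B) = rev B ! ((q + i) mod length B)"
    by blast
  have "rotate p B = rotate q (rev B)"
    by (rule nth_equalityI) (simp_all add: nth_rotate pq)
  then have "rotate (q * (length B - 1) + p) B = rotate (q * (length B - 1) + q) (rev B)"
    by (metis rotate_rotate comp_apply)
  also have "q * (length B - 1) + q = q * length B"
    using assms by (cases B) auto
  also have "rotate (q * length B) (rev B) = rev B"
    by (rule rotate_id) simp
  finally show "\<exists>j. rotate j B = rev B" by blast
qed

section \<open>Conjugate quadratic irrationals\<close>

text \<open>A real quadratic irrational and its algebraic conjugate, characterised by rational trace and
  norm: with this description, stability under translation and inversion is a computation with
  rational numbers.\<close>

definition conjugates :: "real \<Rightarrow> real \<Rightarrow> bool" where
  "conjugates x x' \<longleftrightarrow> x \<notin> \<rat> \<and> x + x' \<in> \<rat> \<and> x * x' \<in> \<rat>"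

lemma conjugates_sym:
  assumes "conjugates x x'"
  shows "conjugates x' x"
proof -
  have "x' \<notin> \<rat>"
    using assms Rats_diff[of "x + x'" x'] by (auto simp: conjugates_def)
  then show ?thesis
    using assms by (simp add: conjugates_def add.commute mult.commute)
qed

lemma conjugates_irrational:
  "conjugates x x' \<Longrightarrow> x \<notin> \<rat>" "conjugates x x' \<Longrightarrow> x' \<notin> \<rat>"
  using conjugates_sym[of x x'] by (simp_all add: conjugates_def)

text \<open>If \<open>y\<close> and \<open>z\<close> are both conjugate to \<open>x\<close>, then \<open>y - z\<close> and \<open>x (y - z)\<close> are rational,
  which is impossible for irrational \<open>x\<close> unless \<open>y = z\<close>.\<close>

lemma conjugates_unique:
  assumes "conjugates x y" "conjugates x z"
  shows "y = z"
proof (rule ccontr)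
  assume "y \<noteq> z"
  have "(x + y) - (x + z) \<in> \<rat>" "x * y - x * z \<in> \<rat>"
    using assms Rats_diff unfolding conjugates_def by blast+
  then have "y - z \<in> \<rat>" "x * (y - z) \<in> \<rat>"
    by (simp_all add: right_diff_distrib)
  then have "x * (y - z) / (y - z) \<in> \<rat>"
    by (metis Rats_divide)
  then show False
    using \<open>y \<noteq> z\<close> conjugates_irrational(1)[OF assms(1)] by simp
qed

lemma conjugates_neq:
  assumes "conjugates x x'"
  shows "x \<noteq> x'"
proof
  assume "x = x'"
  then have "(x + x) / 2 \<in> \<rat>"
    using assms by (intro Rats_divide) (auto simp: conjugates_def)
  then show False
    using conjugates_irrational(1)[OF assms] by simp
qed

lemma conjugates_diff_int:
  assumes "conjugates x x'"
  shows "conjugates (x - of_int n) (x' - of_int n)"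
proof -
  have r: "x + x' \<in> \<rat>" "x * x' \<in> \<rat>" using assms by (auto simp: conjugates_def)
  have "x + x' - 2 * of_int n \<in> \<rat>" "x * x' - of_int n * (x + x') + of_int n * of_int n \<in> \<rat>"
    using Rats_diff[OF r(1), of "of_int (2 * n)"]
      Rats_add[OF Rats_diff[OF r(2) Rats_mult[OF Rats_of_int r(1)]] Rats_of_int, of n "n * n"]
    by simp_all
  then show ?thesis
    using irrational_diff_int conjugates_irrational(1)[OF assms]
    by (auto simp: conjugates_def algebra_simps)
qed

lemma conjugates_inverse:
  assumes "conjugates x x'"
  shows "conjugates (1 / x) (1 / x')"
proof -
  have r: "x + x' \<in> \<rat>" "x * x' \<in> \<rat>" using assms by (auto simp: conjugates_def)
  have nz: "x \<noteq> 0" "x' \<noteq> 0" using conjugates_irrational[OF assms] by auto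
  have "(x + x') / (x * x') \<in> \<rat>" "1 / (x * x') \<in> \<rat>"
    using r by (intro Rats_divide Rats_1; simp)+
  then show ?thesis
    using nz irrational_inverse conjugates_irrational(1)[OF assms]
    by (auto simp: conjugates_def field_simps)
qed

section \<open>Galois' theorem on reversed periods\<close>

text \<open>The conjugates of the complete quotients of \<open>x\<close>: the algorithm subtracts integers and
  inverts, and both steps commute with conjugation, so the conjugate \<open>x'\<close> is simply driven by the
  elements of \<open>x\<close> (which are not its own).\<close>

primrec conjugate_quotient :: "real \<Rightarrow> real \<Rightarrow> nat \<Rightarrow> real" where
  "conjugate_quotient x x' 0 = x'"
| "conjugate_quotient x x' (Suc i) =
     1 / (conjugate_quotient x x' i - of_int \<lfloor>complete_quotient x i\<rfloor>)"

lemma conjugates_complete_quotient: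
  assumes "conjugates x x'"
  shows "conjugates (complete_quotient x i) (conjugate_quotient x x' i)"
proof (induction i)
  case (Suc i)
  show ?case
    unfolding complete_quotient_Suc_floor conjugate_quotient.simps(2)
    by (intro conjugates_inverse conjugates_diff_int Suc)
qed (use assms in simp)

lemma moebius_related_conjugate_quotient:
  assumes "conjugates x x'"
  shows "moebius_related ((- 1) ^ i) x' (conjugate_quotient x x' i)"
proof (induction i)
  case 0
  show ?case by (rule moebius_relatedI[of 1 1 0 0]) auto
next
  case (Suc i)
  have "conjugate_quotient x x' i \<noteq> of_int \<lfloor>complete_quotient x i\<rfloor>"
    using conjugates_irrational(2)[OF conjugates_complete_quotient[OF assms, of i]]
    by (metis Rats_of_int)
  from moebius_related_trans[OF Suc moebius_related_inverse_diff[OF this]]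
  show ?case by simp
qed

text \<open>Were all these conjugates positive, each would exceed the element subtracted from it, by less
  than \<open>1\<close> because its successor is above \<open>1\<close>. The elements of \<open>x\<close> would thus be those of \<open>x'\<close>
  as well, and \<open>x'\<close> would equal \<open>x\<close>.\<close>

lemma ex_negative_conjugate_quotient:
  assumes conj: "conjugates x x'"
  shows "\<exists>i. conjugate_quotient x x' i < 0"
proof (rule ccontr)
  let ?u = "conjugate_quotient x x'" and ?a = "\<lambda>i. \<lfloor>complete_quotient x i\<rfloor>"
  assume "\<not> ?thesis"
  moreover have "?u i \<noteq> 0" for i
    using conjugates_irrational(2)[OF conjugates_complete_quotient[OF conj, of i]] by auto
  ultimately have pos: "?u i > 0" for i
    by (metis linorder_neqE_linordered_idom)
  have gt: "?u i > of_int (?a i)" for i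
    using pos[of "Suc i"] by simp
  have "?u i - of_int (?a i) < 1" for i
  proof -
    have "1 < ?u (Suc i)"
      using gt[of "Suc i"] floor_complete_quotient_ge_1[OF conjugates_irrational(1)[OF conj], of "Suc i"]
      by linarith
    then show ?thesis
      using gt[of i] by (simp add: field_simps)
  qed
  then have floor: "\<lfloor>?u i\<rfloor> = ?a i" for i
    using gt[of i] by (intro floor_unique) (auto simp: less_imp_le algebra_simps)
  have "complete_quotient x' i = ?u i" for i
  proof (induction i)
    case (Suc i)
    then show ?case
      unfolding complete_quotient_Suc_floor by (simp add: floor)
  qed simp
  then have "x' = x"
    using complete_quotient_unique[of x' x] conjugates_irrational[OF conj] floor by simp
  then show False
    using conjugates_neq[OF conj] by simp
qed

text \<open>A negative conjugate stays negative when nonnegative integers are subtracted from it before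
  inverting; once positive integers are subtracted, it lies in the interval from \<open>- 1\<close> to \<open>0\<close>.
  Positivity of \<open>x\<close> guarantees that already the first element is nonnegative.\<close>

lemma eventually_reduced:
  assumes conj: "conjugates x x'" and "x > 0"
  shows "\<exists>N. \<forall>i\<ge>N. - 1 < conjugate_quotient x x' i \<and> conjugate_quotient x x' i < 0"
proof -
  let ?u = "conjugate_quotient x x'" and ?a = "\<lambda>i. \<lfloor>complete_quotient x i\<rfloor>"
  have a: "?a i \<ge> 1" if "i > 0" for i
    by (rule floor_complete_quotient_ge_1[OF conjugates_irrational(1)[OF conj] that])
  have a0: "?a i \<ge> 0" for i
    using a[of i] \<open>x > 0\<close> by (cases "i = 0") auto
  obtain M where M: "?u M < 0"
    using ex_negative_conjugate_quotient[OF conj] by blast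
  have neg: "?u (M + j) < 0" for j
  proof (induction j)
    case (Suc j)
    have "?u (M + j) - of_int (?a (M + j)) < 0"
      using Suc a0[of "M + j"] by linarith
    then show ?case by simp
  qed (use M in simp)
  have red: "- 1 < ?u (M + Suc (Suc j))" for j
  proof -
    have "?u (M + Suc j) - of_int (?a (M + Suc j)) < - 1"
      using neg[of "Suc j"] a[of "M + Suc j"] by linarith
    then have "- 1 < 1 / (?u (M + Suc j) - of_int (?a (M + Suc j)))"
      by (simp add: field_simps)
    then show ?thesis by simp
  qed
  have "- 1 < ?u i \<and> ?u i < 0" if "i \<ge> M + 2" for i
  proof -
    have "i = M + Suc (Suc (i - M - 2))"
      using that by simp
    then show ?thesis
      using red neg by metis
  qed
  then show ?thesis by blast
qed

text \<open>Put \<open>\<rho> i = - 1 / u i\<close>, where \<open>u i\<close> is the conjugate of the \<open>i\<close>-th complete quotient. Then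
  \<open>u (i + 1) = 1 / (u i - a i)\<close> turns into \<open>\<rho> (i + 1) = a i + 1 / \<rho> i\<close>, and \<open>\<rho> i > 1\<close> once the
  quotients are reduced. So this is the continued fraction algorithm for \<open>\<rho>\<close>, running through the
  elements of \<open>x\<close> backwards. Since \<open>\<rho>\<close> is periodic along with \<open>x\<close>, one may start as far out as
  needed and read the reversed block as often as desired.\<close>

lemma galois_reversed_period:
  fixes x x' :: real and B :: "int list"
  defines "r \<equiv> length B"
  assumes conj: "conjugates x x'" and "B \<noteq> []"
    and digits: "\<And>i. \<lfloor>complete_quotient x (K + i)\<rfloor> = B ! (i mod r)"
    and reduced: "\<And>i. i \<ge> K \<Longrightarrow> - 1 < conjugate_quotient x x' i \<and> conjugate_quotient x x' i < 0"
  shows "\<lfloor>complete_quotient (- 1 / conjugate_quotient x x' K) i\<rfloor> = rev B ! (i mod r)"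
proof -
  have r0: "r > 0" using \<open>B \<noteq> []\<close> by (simp add: r_def)
  define \<rho> where "\<rho> = (\<lambda>i. - 1 / conjugate_quotient x x' i)"
  let ?a = "\<lambda>i. \<lfloor>complete_quotient x i\<rfloor>"
  have \<rho>_gt: "\<rho> j > 1" if "j \<ge> K" for j
    using reduced[OF that] by (simp add: \<rho>_def field_simps)
  have \<rho>_Suc: "\<rho> (Suc j) = of_int (?a j) + 1 / \<rho> j" if "j \<ge> K" for j
    using reduced[OF that] by (simp add: \<rho>_def field_simps)
  have floor_\<rho>: "\<lfloor>\<rho> (Suc j)\<rfloor> = ?a j" if "j \<ge> K" for j
    using \<rho>_gt[OF that] by (intro floor_unique) (auto simp: \<rho>_Suc[OF that])
  have cq_\<rho>: "complete_quotient (\<rho> (K + n)) i = \<rho> (K + n - i)" if "i \<le> n" for n i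
    using that
  proof (induction i)
    case (Suc i)
    define j where "j = K + n - Suc i"
    have j: "K + n - i = Suc j" "j = K + n - Suc i" "j \<ge> K"
      using Suc.prems by (simp_all add: j_def)
    show ?case
      unfolding complete_quotient_Suc_floor
      using Suc floor_\<rho>[OF j(3)] \<rho>_Suc[OF j(3)] j by simp
  qed simp
  have per: "\<rho> (K + r * n) = \<rho> K" for n
  proof -
    have "complete_quotient x (K + r * n) = complete_quotient x K"
    proof (rule complete_quotient_unique)
      show "\<lfloor>complete_quotient (complete_quotient x (K + r * n)) i\<rfloor>
        = \<lfloor>complete_quotient (complete_quotient x K) i\<rfloor>" for i
        unfolding complete_quotient_add[symmetric] add.assoc digits by simp
    qed (simp_all only: complete_quotient_irrational conjugates_irrational(1)[OF conj] not_False_eq_True)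
    then have "conjugate_quotient x x' (K + r * n) = conjugate_quotient x x' K"
      using conjugates_complete_quotient[OF conj] conjugates_unique by metis
    then show ?thesis by (simp add: \<rho>_def)
  qed
  \<comment> \<open>Start \<open>n\<close> full periods later, just far enough for \<open>i\<close> backward steps to be available.\<close>
  define n k where "n = Suc (i div r)" and "k = i mod r"
  have i: "i = r * (i div r) + k" and k: "k < r"
    using r0 by (simp_all add: k_def)
  have rn: "r * n = i + (r - k)"
    using i k by (simp add: n_def)
  have "complete_quotient (\<rho> K) i = \<rho> (K + r * n - i)"
    using cq_\<rho>[of i "r * n"] per[of n] rn by simp
  also have "K + r * n - i = Suc (K + (r - Suc k))"
    using rn k by simp
  finally have "\<lfloor>complete_quotient (\<rho> K) i\<rfloor> = ?a (K + (r - Suc k))"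
    using floor_\<rho>[of "K + (r - Suc k)"] by simp
  also have "\<dots> = B ! ((r - Suc k) mod r)"
    by (rule digits)
  also have "\<dots> = rev B ! k"
    using k r0 by (simp add: rev_nth r_def)
  finally show ?thesis
    by (simp add: \<rho>_def k_def)
qed

text \<open>Two separate facts combine here. By Serret's theorem \<open>x\<close> is related to itself with determinant
  \<open>- 1\<close> if and only if some tail recurs after an odd shift; such a recurrence is also what makes
  the sequence eventually periodic when the relations are given. And \<open>x\<close> is related to its
  conjugate, with either determinant, if and only if the block and its reversal have a common tail, because a late complete quotient
  \<open>y\<close> of \<open>x\<close> is related to \<open>x\<close>, while the number \<open>z\<close> with the reversed block is related to \<open>x'\<close>.\<close>

lemma palindromic_odd_period_iff:
  fixes x x' :: real
  assumes conj: "conjugates x x'" and "x > 0"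
  defines "P \<equiv> period (\<lambda>i. \<lfloor>complete_quotient x i\<rfloor>)"
  shows "palindromic_period P \<and> odd_period P \<longleftrightarrow>
    moebius_related (- 1) x x \<and> (moebius_related 1 x x' \<or> moebius_related (- 1) x x')"
proof -
  let ?a = "\<lambda>i. \<lfloor>complete_quotient x i\<rfloor>"
  let ?R = "\<lambda>y z. moebius_related 1 y z \<or> moebius_related (- 1) y z"
  have x: "x \<notin> \<rat>" and x': "x' \<notin> \<rat>" using conjugates_irrational[OF conj] by auto
  have R_trans: "?R y w" if "?R y z" "?R z w" for y z w
    using that moebius_related_trans[of _ y z _ w] by fastforce
  have R_sym: "?R z y" if "?R y z" for y z
    using that moebius_related_sym by blast
  have R_unit: "?R y z" if "moebius_related ((- 1) ^ i) y z" for y z i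
    using that by (cases "even i") auto
  have cycle: "(\<exists>j. rotate j B = rev B) \<longleftrightarrow> ?R x x'" if B: "B \<in> P" for B
  proof -
    let ?r = "length B"
    have ne: "B \<noteq> []" using B by (auto simp: P_def period_def repeating_block_def)
    obtain N where N: "\<And>i. ?a (N + i) = B ! (i mod ?r)"
      using B by (auto simp: P_def period_def repeating_block_def)
    obtain M where M: "\<And>i. i \<ge> M \<Longrightarrow> - 1 < conjugate_quotient x x' i \<and> conjugate_quotient x x' i < 0"
      using eventually_reduced[OF conj \<open>x > 0\<close>] by blast
    \<comment> \<open>A late start of the same block \<open>B\<close>, by a multiple of its length, in the reduced range.\<close>
    define K where "K = N + ?r * M"
    have KM: "K \<ge> M"
      using ne by (cases B) (simp_all add: K_def)
    have digits: "?a (K + i) = B ! (i mod ?r)" for i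
      unfolding K_def add.assoc N by simp
    define y z where "y = complete_quotient x K" and "z = - 1 / conjugate_quotient x x' K"
    have y: "y \<notin> \<rat>" unfolding y_def by (rule complete_quotient_irrational[OF x])
    have u: "conjugate_quotient x x' K \<notin> \<rat>"
      using conjugates_irrational(2) conjugates_complete_quotient[OF conj] by blast
    then have z: "z \<notin> \<rat>"
      using irrational_uminus[OF irrational_inverse[OF u]] by (simp add: z_def)
    have dy: "\<lfloor>complete_quotient (complete_quotient y p) i\<rfloor> = B ! ((p + i) mod ?r)" for p i
      unfolding y_def complete_quotient_add[symmetric] add.assoc by (rule digits)
    have dz: "\<lfloor>complete_quotient (complete_quotient z p) i\<rfloor> = rev B ! ((p + i) mod ?r)" for p i
      unfolding z_def complete_quotient_add[symmetric]
      by (rule galois_reversed_period[OF conj ne digits]) (use M KM in auto)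
    have "(\<exists>j. rotate j B = rev B) \<longleftrightarrow> (\<exists>p q. complete_quotient y p = complete_quotient z q)"
    proof -
      have "(complete_quotient y p = complete_quotient z q) \<longleftrightarrow>
        (\<forall>i. B ! ((p + i) mod ?r) = rev B ! ((q + i) mod ?r))" for p q
      proof
        assume "complete_quotient y p = complete_quotient z q"
        then show "\<forall>i. B ! ((p + i) mod ?r) = rev B ! ((q + i) mod ?r)"
          using dy[of p] dz[of q] by metis
      next
        assume *: "\<forall>i. B ! ((p + i) mod ?r) = rev B ! ((q + i) mod ?r)"
        show "complete_quotient y p = complete_quotient z q"
          by (rule complete_quotient_unique[OF complete_quotient_irrational[OF y]
                complete_quotient_irrational[OF z]])
            (simp only: dy dz *)
      qed
      then show ?thesis
        unfolding rotation_eq_rev_iff[OF ne] by simp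
    qed
    also have "\<dots> \<longleftrightarrow> (\<exists>e\<in>{1, - 1}. tails_meet e y z)"
    proof -
      have "(- 1) ^ i \<in> {1, - 1 :: int}" for i :: nat
        by (cases "even i") auto
      then show ?thesis
        unfolding tails_meet_def by blast
    qed
    also have "\<dots> \<longleftrightarrow> ?R y z"
      using moebius_related_imp_tails_meet[OF _ _ y z] tails_meet_imp_moebius_related[OF _ y z]
      by blast
    also have "\<dots> \<longleftrightarrow> ?R x x'"
    proof -
      have xy: "?R x y"
        using R_unit[OF moebius_related_complete_quotient[OF x]] unfolding y_def .
      have xz: "?R x' z"
      proof (rule R_trans)
        show "?R x' (conjugate_quotient x x' K)"
          by (rule R_unit[OF moebius_related_conjugate_quotient[OF conj]])
        show "?R (conjugate_quotient x x' K) z"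
        proof -
          have "conjugate_quotient x x' K \<noteq> 0" using u by auto
          from moebius_related_uminus_inverse[OF this] show ?thesis
            unfolding z_def by blast
        qed
      qed
      show ?thesis
      proof
        assume "?R y z"
        then show "?R x x'" by (rule R_trans[OF R_trans[OF xy] R_sym[OF xz]])
      next
        assume "?R x x'"
        then show "?R y z" by (rule R_trans[OF R_trans[OF R_sym[OF xy]] xz])
      qed
    qed
    finally show ?thesis .
  qed
  show ?thesis
  proof
    assume *: "palindromic_period P \<and> odd_period P"
    obtain B where B: "B \<in> P" "odd (length B)"
      using * unfolding odd_period_def by blast
    obtain C where C: "C \<in> P" "\<exists>j. rotate j C = rev C"
      using * unfolding palindromic_period_def by blast
    obtain N where N: "\<And>i. i \<ge> N \<Longrightarrow> ?a (i + length B) = ?a i"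
      using repeating_block_shift[of ?a B] B(1) by (auto simp: P_def period_def)
    have "complete_quotient x (N + length B) = complete_quotient x N"
    proof (rule complete_quotient_unique)
      show "\<lfloor>complete_quotient (complete_quotient x (N + length B)) i\<rfloor>
        = \<lfloor>complete_quotient (complete_quotient x N) i\<rfloor>" for i
        unfolding complete_quotient_add[symmetric] using N[of "N + i"] by (simp add: ac_simps)
    qed (simp_all only: complete_quotient_irrational x not_False_eq_True)
    then have "tails_meet (- 1) x x"
      using B(2) by (intro tails_meetI[of x "N + length B" x N]) (simp_all add: minus_one_power_iff)
    then show "moebius_related (- 1) x x \<and> ?R x x'"
      using tails_meet_imp_moebius_related[OF _ x x] iffD1[OF cycle[OF C(1)] C(2)] by simp
  next
    assume *: "moebius_related (- 1) x x \<and> ?R x x'"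
    then have "tails_meet (- 1) x x"
      by (intro moebius_related_imp_tails_meet[OF _ _ x x]) simp_all
    then obtain i j where ij: "complete_quotient x i = complete_quotient x j" "odd (i + j)"
      unfolding tails_meet_def by (auto simp: minus_one_power_iff split: if_splits)
    then obtain N d where Nd: "complete_quotient x (N + d) = complete_quotient x N" "odd d"
    proof (cases "i \<le> j")
      case True
      then show ?thesis using ij that[of i "j - i"] by auto
    next
      case False
      then show ?thesis using ij that[of j "i - j"] by auto
    qed
    have shift: "?a (l + d) = ?a l" if "l \<ge> N" for l
    proof -
      have "complete_quotient x (l + d) = complete_quotient (complete_quotient x (N + d)) (l - N)"
        unfolding complete_quotient_add[symmetric] using that by (simp add: ac_simps)
      also have "\<dots> = complete_quotient x l"
        unfolding Nd(1) complete_quotient_add[symmetric] using that by simp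
      finally show ?thesis by simp
    qed
    have "d > 0" using Nd(2) by (cases d) auto
    then obtain B where B: "B \<in> P"
      using period_nonempty[of d N ?a] shift unfolding P_def by blast
    have "length B dvd d"
      using length_period_dvd[of B ?a N d] B shift unfolding P_def by blast
    then have "odd (length B)"
      using Nd(2) by (metis dvd_trans)
    then show "palindromic_period P \<and> odd_period P"
      using B iffD2[OF cycle[OF B] conjunct2[OF *]]
      unfolding palindromic_period_def odd_period_def by blast
  qed
qed

section \<open>Binary quadratic forms and their roots\<close>

fun substitute :: "form \<Rightarrow> int \<Rightarrow> int \<Rightarrow> int \<Rightarrow> int \<Rightarrow> form" where
  "substitute (m, n, k) a b c d =
     (m * a\<^sup>2 + n * c\<^sup>2 + k * a * c,
      m * b\<^sup>2 + n * d\<^sup>2 + k * b * d,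
      2 * m * a * b + 2 * n * c * d + k * (a * d + b * c))"

lemma form_value_substitute:
  "form_value (substitute f a b c d) x y = form_value f (a * x + b * y) (c * x + d * y)"
  by (cases f) (simp add: power2_eq_square algebra_simps)

lemma form_class_iff_substitute:
  "g \<in> form_class f \<longleftrightarrow> (\<exists>a b c d. a * d - b * c = 1 \<and> g = substitute f a b c d)"
proof -
  have "(\<forall>x y. form_value g x y = form_value f (a * x + b * y) (c * x + d * y)) \<longleftrightarrow>
      g = substitute f a b c d" for a b c d
    using form_value_inject[of g "substitute f a b c d"] by (auto simp: form_value_substitute)
  then show ?thesis
    unfolding form_class_def by simp
qed

lemma form_classI:
  assumes "a * d - b * c = 1"
    and "\<And>x y. form_value g x y = form_value f (a * x + b * y) (c * x + d * y)"
  shows "g \<in> form_class f"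
  unfolding form_class_def mem_Collect_eq
  using assms by (intro exI[of _ a] exI[of _ b] exI[of _ c] exI[of _ d]) simp

lemma form_classE:
  assumes "g \<in> form_class f"
  obtains a b c d where "a * d - b * c = 1"
    "\<And>x y. form_value g x y = form_value f (a * x + b * y) (c * x + d * y)"
  using assms unfolding form_class_def mem_Collect_eq by (elim exE conjE) (rule that, auto)

lemma form_class_refl: "f \<in> form_class f"
  by (rule form_classI[of 1 1 0 0]) auto

lemma form_class_sym:
  assumes "g \<in> form_class f"
  shows "f \<in> form_class g"
proof -
  obtain a b c d where A: "a * d - b * c = 1"
    "\<And>x y. form_value g x y = form_value f (a * x + b * y) (c * x + d * y)"
    by (rule form_classE[OF assms]) (rule that)
  show ?thesis
  proof (rule form_classI[of d a "- b" "- c"])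
    fix x y
    have "a * (d * x + - b * y) + b * (- c * x + a * y) = (a * d - b * c) * x"
      "c * (d * x + - b * y) + d * (- c * x + a * y) = (a * d - b * c) * y"
      by (simp_all add: algebra_simps)
    then show "form_value f x y = form_value g (d * x + - b * y) (- c * x + a * y)"
      unfolding A by simp
  qed (use A(1) in \<open>simp add: algebra_simps\<close>)
qed

lemma form_class_trans:
  assumes "g \<in> form_class f" "h \<in> form_class g"
  shows "h \<in> form_class f"
proof -
  obtain a b c d where A: "a * d - b * c = 1"
    "\<And>x y. form_value g x y = form_value f (a * x + b * y) (c * x + d * y)"
    by (rule form_classE[OF assms(1)]) (rule that)
  obtain a' b' c' d' where B: "a' * d' - b' * c' = 1"
    "\<And>x y. form_value h x y = form_value g (a' * x + b' * y) (c' * x + d' * y)"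
    by (rule form_classE[OF assms(2)]) (rule that)
  show ?thesis
  proof (rule form_classI[of "a * a' + b * c'" "c * b' + d * d'" "a * b' + b * d'" "c * a' + d * c'"])
    have "(a * a' + b * c') * (c * b' + d * d') - (a * b' + b * d') * (c * a' + d * c')
        = (a * d - b * c) * (a' * d' - b' * c')"
      by (simp add: algebra_simps)
    then show "(a * a' + b * c') * (c * b' + d * d') - (a * b' + b * d') * (c * a' + d * c') = 1"
      using A(1) B(1) by simp
  qed (simp add: A(2) B(2) algebra_simps)
qed

lemma form_class_eq_iff: "form_class g = form_class f \<longleftrightarrow> g \<in> form_class f"
  using form_class_refl form_class_sym form_class_trans by blast

lemma form_value_conjugate: "form_value (conjugate f) x y = form_value f x (- y)"
  by (cases f) simp

lemma form_value_adjoint: "form_value (adjoint f) x y = - form_value f y (- x)"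
  by (cases f) (simp add: algebra_simps)

lemma conjugate_mem_form_class:
  assumes "g \<in> form_class f"
  shows "conjugate g \<in> form_class (conjugate f)"
proof -
  obtain a b c d where A: "a * d - b * c = 1"
    "\<And>x y. form_value g x y = form_value f (a * x + b * y) (c * x + d * y)"
    by (rule form_classE[OF assms]) (rule that)
  show ?thesis
    by (rule form_classI[of a d "- b" "- c"]) (use A in \<open>simp_all add: form_value_conjugate\<close>)
qed

lemma adjoint_mem_form_class:
  assumes "g \<in> form_class f"
  shows "adjoint g \<in> form_class (adjoint f)"
proof -
  obtain a b c d where A: "a * d - b * c = 1"
    "\<And>x y. form_value g x y = form_value f (a * x + b * y) (c * x + d * y)"
    by (rule form_classE[OF assms]) (rule that)
  show ?thesis
    by (rule form_classI[of d a "- c" "- b"])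
      (use A in \<open>simp_all add: form_value_adjoint algebra_simps\<close>)
qed

text \<open>An involution that respects proper equivalence maps the class of \<open>f\<close> onto that of its image, so
  invariance of the class may be tested on the single form \<open>f\<close>.\<close>

lemma involution_image_form_class_iff:
  assumes invol: "\<And>g. \<sigma> (\<sigma> g) = g"
    and mono: "\<And>f g. g \<in> form_class f \<Longrightarrow> \<sigma> g \<in> form_class (\<sigma> f)"
  shows "\<sigma> ` form_class f = form_class f \<longleftrightarrow> \<sigma> f \<in> form_class f"
proof -
  have "\<sigma> ` form_class f = form_class (\<sigma> f)"
  proof (intro equalityI subsetI)
    fix g assume "g \<in> form_class (\<sigma> f)"
    then have "\<sigma> g \<in> form_class f"
      using mono[of g "\<sigma> f"] invol by simp
    then show "g \<in> \<sigma> ` form_class f"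
      using invol[of g] by (metis imageI)
  next
    fix g assume "g \<in> \<sigma> ` form_class f"
    then show "g \<in> form_class (\<sigma> f)"
      using mono by blast
  qed
  then show ?thesis
    by (simp add: form_class_eq_iff)
qed

lemma supersymmetric_iff:
  "supersymmetric (form_class f) \<longleftrightarrow> conjugate f \<in> form_class f \<and> adjoint f \<in> form_class f"
proof -
  have "conjugate (conjugate g) = g" "adjoint (adjoint g) = g" for g
    by (cases g; simp)+
  then show ?thesis
    unfolding supersymmetric_def
    by (simp add: involution_image_form_class_iff conjugate_mem_form_class adjoint_mem_form_class)
qed

lemma sqrt_irrational:
  fixes D :: int
  assumes "D > 0" "\<nexists>s :: int. D = s\<^sup>2"
  shows "sqrt (of_int D) \<notin> \<rat>"
proof
  assume "sqrt (of_int D) \<in> \<rat>"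
  then obtain p q :: nat where pq: "q \<noteq> 0" "\<bar>sqrt (of_int D)\<bar> = of_nat p / of_nat q" "coprime p q"
    by (rule Rats_abs_nat_div_natE)
  have "of_int D = (of_nat p / of_nat q :: real)\<^sup>2"
    using pq(2)[symmetric] assms(1) by simp
  then have "of_int D * (of_nat q)\<^sup>2 = (of_nat p :: real)\<^sup>2"
    using pq(1) by (simp add: field_simps)
  then have "of_int (D * (int q)\<^sup>2) = (of_int ((int p)\<^sup>2) :: real)"
    by simp
  then have eq: "D * (int q)\<^sup>2 = (int p)\<^sup>2"
    by (simp only: of_int_eq_iff)
  then have "(int q)\<^sup>2 dvd (int p)\<^sup>2"
    by (metis dvd_triv_right)
  moreover have "coprime ((int p)\<^sup>2) ((int q)\<^sup>2)"
    using pq(3) by simp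
  ultimately have "is_unit ((int q)\<^sup>2)"
    by (metis coprime_common_divisor dvd_refl)
  then have "(int q)\<^sup>2 = 1"
    by simp
  then show False
    using eq assms(2) by auto
qed

text \<open>The other root of the form. Conjugating a form changes the sign of \<open>k\<close>, hence negates both roots
  and exchanges them.\<close>

definition xi_minus :: "form \<Rightarrow> real" where
  "xi_minus f = - xi_plus (conjugate f)"

definition irrational_form :: "form \<Rightarrow> bool" where
  "irrational_form f \<longleftrightarrow> form_disc f > 0 \<and> (\<nexists>s :: int. form_disc f = s\<^sup>2)"

lemma irrational_form_nonzero:
  assumes "irrational_form (m, n, k)"
  shows "m \<noteq> 0" "n \<noteq> 0"
  using assms by (auto simp: irrational_form_def)

lemma sqrt_disc_irrational: "irrational_form f \<Longrightarrow> sqrt (of_int (form_disc f)) \<notin> \<rat>"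
  using sqrt_irrational unfolding irrational_form_def by blast

lemma xi_plus_alt:
  "xi_plus (m, n, k) = (- of_int k + sqrt (of_int (form_disc (m, n, k)))) / (2 * of_int m)"
  "xi_minus (m, n, k) = (- of_int k - sqrt (of_int (form_disc (m, n, k)))) / (2 * of_int m)"
proof -
  show "xi_plus (m, n, k) = (- of_int k + sqrt (of_int (form_disc (m, n, k)))) / (2 * of_int m)"
    by simp
  have "- ((r + s) / t) = (- r - s) / t" for r s t :: real
    by (metis minus_add_distrib minus_divide_left uminus_add_conv_diff add.commute diff_conv_add_uminus)
  from this[of "of_int k"]
  show "xi_minus (m, n, k) = (- of_int k - sqrt (of_int (form_disc (m, n, k)))) / (2 * of_int m)"
    by (simp add: xi_minus_def)
qed

lemma sqrt_disc_squared:
  assumes "irrational_form (m, n, k)"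
  shows "(sqrt (of_int (form_disc (m, n, k))))\<^sup>2 = (of_int k)\<^sup>2 - 4 * of_int m * of_int n"
proof -
  have "(sqrt (of_int (form_disc (m, n, k))))\<^sup>2 = of_int (form_disc (m, n, k))"
    using assms unfolding irrational_form_def by (intro real_sqrt_pow2) (simp del: form_disc.simps)
  then show ?thesis by simp
qed

lemma xi_plus_irrational:
  assumes "irrational_form f"
  shows "xi_plus f \<notin> \<rat>"
proof (cases f)
  case (fields m n k)
  let ?s = "sqrt (of_int (form_disc f))"
  have "?s = of_int (2 * m) * xi_plus f + of_int k"
    using irrational_form_nonzero(1)[OF assms[unfolded fields]]
    by (simp add: fields xi_plus_alt(1) field_simps del: xi_plus.simps form_disc.simps)
  then show ?thesis
    using sqrt_disc_irrational[OF assms] by (metis Rats_add Rats_mult Rats_of_int)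
qed

lemma conjugates_xi:
  assumes "irrational_form f"
  shows "conjugates (xi_plus f) (xi_minus f)"
proof (cases f)
  case (fields m n k)
  define s where "s = sqrt (of_int (form_disc f))"
  note m = irrational_form_nonzero(1)[OF assms[unfolded fields]]
  note s2 = sqrt_disc_squared[OF assms[unfolded fields], folded fields s_def]
  note xi = xi_plus_alt[of m n k, folded fields s_def]
  have "xi_plus f + xi_minus f = of_int (- k) / of_int m"
    unfolding xi using m by (simp add: field_simps)
  moreover have "xi_plus f * xi_minus f = ((of_int k)\<^sup>2 - s\<^sup>2) / (4 * (of_int m)\<^sup>2)"
    unfolding xi using m by (simp add: field_simps power2_eq_square)
  then have "xi_plus f * xi_minus f = of_int n / of_int m"
    unfolding s2 using m by (simp add: field_simps power2_eq_square)
  ultimately have "xi_plus f + xi_minus f \<in> \<rat>" "xi_plus f * xi_minus f \<in> \<rat>"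
    by (simp_all only: Rats_divide Rats_of_int)
  then show ?thesis
    unfolding conjugates_def using xi_plus_irrational[OF assms] by blast
qed

text \<open>Together with the definition of \<open>xi_minus\<close> this identifies the two involutions on roots: they are
  conjugation of the root followed by \<open>t \<mapsto> - t\<close> of determinant \<open>- 1\<close>, and by \<open>t \<mapsto> - 1 / t\<close> of
  determinant \<open>1\<close>, respectively.\<close>

lemma xi_plus_adjoint:
  assumes "irrational_form f"
  shows "xi_plus (adjoint f) = - 1 / xi_minus f"
proof (cases f)
  case (fields m n k)
  define s where "s = sqrt (of_int (form_disc f))"
  note mn = irrational_form_nonzero[OF assms[unfolded fields]]
  note s2 = sqrt_disc_squared[OF assms[unfolded fields], folded fields s_def]
  note xi = xi_plus_alt(2)[of m n k, folded fields s_def]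
  have x0: "xi_minus f \<noteq> 0"
    using conjugates_irrational(2)[OF conjugates_xi[OF assms]] by auto
  have "form_disc (- n, - m, k) = form_disc f"
    by (simp add: fields)
  then have "xi_plus (adjoint f) = (- of_int k + s) / (2 * of_int (- n))"
    unfolding fields adjoint.simps xi_plus_alt(1) by (simp only: s_def fields)
  then have "xi_plus (adjoint f) * xi_minus f = ((of_int k)\<^sup>2 - s\<^sup>2) / (- 4 * of_int n * of_int m)"
    unfolding xi by (simp add: power2_eq_square algebra_simps)
  also have "\<dots> = - 1"
    unfolding s2 using mn by (simp add: field_simps)
  finally show ?thesis
    using x0 by (simp add: field_simps)
qed

text \<open>For a fixed discriminant \<open>D\<close>, comparing the coefficients of \<open>sqrt D\<close> in the two roots gives
  equal leading coefficients, and the rest follows.\<close>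

lemma form_eqI:
  assumes f: "irrational_form f" and disc: "form_disc g = form_disc f" and xi: "xi_plus g = xi_plus f"
  shows "g = f"
proof (cases f, cases g)
  fix m n k m' n' k' assume fg: "f = (m, n, k)" "g = (m', n', k')"
  let ?s = "sqrt (of_int (form_disc f))"
  have g: "irrational_form g" using f disc by (simp add: irrational_form_def)
  have m: "m \<noteq> 0" "m' \<noteq> 0" using irrational_form_nonzero f g fg by blast+
  have "(- of_int k' + ?s) / (2 * of_int m') = (- of_int k + ?s) / (2 * of_int m)"
    using xi disc by (simp add: fg xi_plus_alt(1) del: xi_plus.simps form_disc.simps)
  then have eq: "?s * of_int (m - m') = of_int (k' * m - k * m')"
    using m by (simp add: field_simps)
  have "m' = m"
  proof (rule ccontr)
    assume "m' \<noteq> m"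
    then have "?s = of_int (k' * m - k * m') / of_int (m - m')"
      unfolding eq[symmetric] by simp
    then show False
      using sqrt_disc_irrational[OF f] by (metis Rats_divide Rats_of_int)
  qed
  moreover from this have "of_int (k' * m - k * m) = (0 :: real)"
    using eq by simp
  then have "k' = k"
    using m by (simp only: of_int_eq_0_iff) simp
  ultimately show "g = f"
    using disc m by (simp add: fg)
qed

text \<open>That some root is carried to a root is clear; the point is that determinant \<open>1\<close> carries the
  root with \<open>+ sqrt D\<close> to the root with \<open>+ sqrt D\<close>. After clearing denominators both sides are linear
  in \<open>s = sqrt D\<close>, and the coefficients of \<open>s\<close> and of \<open>1\<close> agree because of the identities that
  are proved first, in homogeneous form, with a factor \<open>a d - b c\<close>.\<close>

lemma substitute_root:
  assumes f: "irrational_form f" and det: "a * d - b * c = 1"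
  defines "g \<equiv> substitute f a b c d"
  shows "form_disc g = form_disc f"
    and "xi_plus f * (of_int c * xi_plus g + of_int d) = of_int a * xi_plus g + of_int b"
proof -
  obtain m n k where fields: "f = (m, n, k)" by (cases f) auto
  obtain M N K where g: "g = (M, N, K)" by (cases g) auto
  have MNK: "M = m * a\<^sup>2 + n * c\<^sup>2 + k * a * c" "N = m * b\<^sup>2 + n * d\<^sup>2 + k * b * d"
    "K = 2 * m * a * b + 2 * n * c * d + k * (a * d + b * c)"
    using g by (simp_all add: g_def fields)
  have "form_disc g = (a * d - b * c)\<^sup>2 * form_disc f"
    by (simp add: g MNK fields power2_eq_square algebra_simps)
  then show disc: "form_disc g = form_disc f"
    using det by simp
  then have "irrational_form g" using f by (simp add: irrational_form_def)
  then have M0: "M \<noteq> 0" and m0: "m \<noteq> 0"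
    using irrational_form_nonzero(1) g f fields by auto
  define s where "s = sqrt (of_int (form_disc f))"
  have s: "s * s = of_int (form_disc f)"
    using f by (simp add: s_def irrational_form_def)
  have xi_f: "xi_plus f = (s - of_int k) / (2 * of_int m)"
    unfolding s_def fields xi_plus_alt(1) by simp
  have xi_g: "xi_plus g = (s - of_int K) / (2 * of_int M)"
    unfolding s_def disc[symmetric] g xi_plus_alt(1) by simp
  have "2 * M * d - c * K = (2 * m * a + k * c) * (a * d - b * c)"
    by (simp add: MNK power2_eq_square algebra_simps)
  then have E1: "2 * M * d - c * K = 2 * m * a + k * c"
    using det by simp
  have "K * (k * c + 2 * m * a) + c * form_disc f * (a * d - b * c) = 2 * M * (d * k + 2 * m * b)"
    by (simp add: MNK fields power2_eq_square algebra_simps)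
  then have E2: "K * (k * c + 2 * m * a) + c * form_disc f = 2 * M * (d * k + 2 * m * b)"
    using det by simp
  have "(s - of_int k) * (of_int c * (s - of_int K) + 2 * of_int M * of_int d)
      = of_int c * (s * s) + s * of_int (2 * M * d - c * K) - s * of_int (k * c)
        + of_int (k * c * K - 2 * M * d * k)"
    by (simp add: algebra_simps)
  also have "\<dots> = s * of_int (2 * m * a) + of_int (c * form_disc f + (k * c * K - 2 * M * d * k))"
    unfolding s E1 by (simp add: algebra_simps)
  also have "c * form_disc f + (k * c * K - 2 * M * d * k) = 4 * M * m * b - 2 * m * a * K"
    using E2 by (simp add: algebra_simps)
  finally have "(s - of_int k) * (of_int c * (s - of_int K) + 2 * of_int M * of_int d)
      = 2 * of_int m * (of_int a * (s - of_int K) + 2 * of_int M * of_int b)"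
    by (simp add: algebra_simps)
  then have main: "(s - of_int k) * (of_int c * (s - of_int K) + 2 * of_int M * of_int d) / (2 * of_int m)
      = of_int a * (s - of_int K) + 2 * of_int M * of_int b"
    using m0 by simp
  have affine: "of_int u * xi_plus g + of_int v
      = (of_int u * (s - of_int K) + 2 * of_int M * of_int v) / (2 * of_int M)" for u v
    unfolding xi_g using M0 by (simp add: add_divide_distrib)
  show "xi_plus f * (of_int c * xi_plus g + of_int d) = of_int a * xi_plus g + of_int b"
    unfolding affine main[symmetric] by (simp add: xi_f)
qed

text \<open>This is the bridge from forms to numbers. For the converse, the form obtained from \<open>f\<close> by the
  given substitution has the same discriminant and the same root as \<open>g\<close>, hence is \<open>g\<close>.\<close>

lemma form_class_iff_moebius_related:
  assumes f: "irrational_form f"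
  shows "g \<in> form_class f \<longleftrightarrow>
    form_disc g = form_disc f \<and> moebius_related 1 (xi_plus f) (xi_plus g)"
proof
  assume "g \<in> form_class f"
  then obtain a b c d where "a * d - b * c = 1" "g = substitute f a b c d"
    unfolding form_class_iff_substitute by blast
  then show "form_disc g = form_disc f \<and> moebius_related 1 (xi_plus f) (xi_plus g)"
    using substitute_root[OF f] by (auto intro: moebius_relatedI)
next
  assume *: "form_disc g = form_disc f \<and> moebius_related 1 (xi_plus f) (xi_plus g)"
  then obtain a b c d :: int where det: "a * d - b * c = 1"
    and eq: "xi_plus f * (of_int c * xi_plus g + of_int d) = of_int a * xi_plus g + of_int b"
    unfolding moebius_related_def by blast
  define h where "h = substitute f a b c d"
  have h: "form_disc h = form_disc f"
    "xi_plus f * (of_int c * xi_plus h + of_int d) = of_int a * xi_plus h + of_int b"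
    using substitute_root[OF f det] by (simp_all add: h_def)
  have nz: "xi_plus f * of_int c - of_int a \<noteq> 0"
  proof
    assume 0: "xi_plus f * of_int c - of_int a = 0"
    show False
    proof (cases "c = 0")
      case True
      then show False using 0 det by simp
    next
      case False
      then have "xi_plus f = of_int a / of_int c"
        using 0 by (simp add: field_simps)
      then show False
        using xi_plus_irrational[OF f] by (metis Rats_divide Rats_of_int)
    qed
  qed
  have "(xi_plus f * of_int c - of_int a) * (xi_plus g - xi_plus h) = 0"
    using eq h(2) by (simp add: algebra_simps)
  then have "xi_plus g = xi_plus h"
    using nz by simp
  moreover have "irrational_form h"
    using f h(1) by (simp add: irrational_form_def)
  ultimately have "g = h"
    using form_eqI[of h g] * h(1) by simp
  then show "g \<in> form_class f"
    using det unfolding form_class_iff_substitute h_def by blast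
qed

lemma conjugate_mem_iff:
  assumes f: "irrational_form f"
  shows "conjugate f \<in> form_class f \<longleftrightarrow> moebius_related (- 1) (xi_plus f) (xi_minus f)"
proof -
  have disc: "form_disc (conjugate f) = form_disc f"
    by (cases f) simp
  have xi: "xi_plus (conjugate f) = - xi_minus f"
    by (simp add: xi_minus_def)
  have "moebius_related 1 y (- z)" if "moebius_related (- 1) y z" for y z
    using moebius_related_trans[OF that moebius_related_uminus] by simp
  moreover have "moebius_related (- 1) y z" if "moebius_related 1 y (- z)" for y z
    using moebius_related_trans[OF that moebius_related_uminus] by simp
  ultimately show ?thesis
    unfolding form_class_iff_moebius_related[OF f] disc xi by blast
qed

lemma adjoint_mem_iff:
  assumes f: "irrational_form f"
  shows "adjoint f \<in> form_class f \<longleftrightarrow> moebius_related 1 (xi_plus f) (xi_minus f)"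
proof -
  have "xi_minus f \<noteq> 0"
    using conjugates_irrational(2)[OF conjugates_xi[OF f]] by (metis Rats_0)
  note inv = moebius_related_uminus_inverse[OF this]
  have disc: "form_disc (adjoint f) = form_disc f"
    by (cases f) simp
  have "moebius_related 1 y (- 1 / xi_minus f)" if "moebius_related 1 y (xi_minus f)" for y
    using moebius_related_trans[OF that inv] by simp
  moreover have "moebius_related 1 y (xi_minus f)" if "moebius_related 1 y (- 1 / xi_minus f)" for y
    using moebius_related_trans[OF that moebius_related_sym[OF inv]] by simp
  ultimately show ?thesis
    unfolding form_class_iff_moebius_related[OF f] disc xi_plus_adjoint[OF f] by blast
qed

text \<open>Supersymmetry says that \<open>x\<close> is related to \<open>x'\<close> with both determinants. Composing one relation
  with the inverse of the other relates \<open>x\<close> to itself with determinant \<open>- 1\<close>; conversely such a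
  self-relation turns either determinant into the other.\<close>

lemma supersymmetric_iff_moebius_related:
  assumes f: "irrational_form f"
  defines "x \<equiv> xi_plus f" and "x' \<equiv> xi_minus f"
  shows "supersymmetric (form_class f) \<longleftrightarrow>
    moebius_related (- 1) x x \<and> (moebius_related 1 x x' \<or> moebius_related (- 1) x x')"
proof -
  have "moebius_related (- 1) x x" if "moebius_related (- 1) x x'" "moebius_related 1 x x'"
    using moebius_related_trans[OF that(1) moebius_related_sym[OF that(2)]] by simp
  moreover have flip: "moebius_related (- e) x x'"
    if "moebius_related (- 1) x x" "moebius_related e x x'" for e
    using moebius_related_trans[OF that] by simp
  have "moebius_related (- 1) x x' \<and> moebius_related 1 x x'"
    if "moebius_related (- 1) x x" "moebius_related 1 x x' \<or> moebius_related (- 1) x x'"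
    using that flip[of 1] flip[of "- 1"] by auto
  ultimately show ?thesis
    unfolding supersymmetric_iff conjugate_mem_iff[OF f] adjoint_mem_iff[OF f]
      x_def[symmetric] x'_def[symmetric]
    by blast
qed

theorem theorem3p6:
  fixes m n k :: int
  assumes "form_disc (m, n, k) > 0"
    and "\<nexists>s :: int. form_disc (m, n, k) = s\<^sup>2"
  shows "palindromic_period (form_period (m, n, k)) \<and> odd_period (form_period (m, n, k))
    \<longleftrightarrow> supersymmetric (form_class (m, n, k))"
proof -
  let ?f = "(m, n, k)"
  have f: "irrational_form ?f"
    using assms unfolding irrational_form_def by blast
  define x x' where "x = xi_plus ?f" and "x' = xi_minus ?f"
  have conj: "conjugates x x'"
    unfolding x_def x'_def by (rule conjugates_xi[OF f])
  have "x \<noteq> 0" using conjugates_irrational(1)[OF conj] by auto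
  \<comment> \<open>The continued fraction is that of \<open>\<bar>x\<bar>\<close>; negating the root together with its conjugate
    preserves all relations between them.\<close>
  obtain y y' where y: "\<bar>x\<bar> = y" "y > 0" "conjugates y y'"
    and same: "\<And>e. moebius_related e y y \<longleftrightarrow> moebius_related e x x"
      "\<And>e. moebius_related e y y' \<longleftrightarrow> moebius_related e x x'"
  proof (cases "x > 0")
    case True
    then show ?thesis using conj by (intro that[of x x']) auto
  next
    case False
    have "conjugates (- x) (- x')"
      using conj unfolding conjugates_def
      by (metis Rats_minus_iff minus_add_distrib minus_mult_minus)
    then show ?thesis
      using False \<open>x \<noteq> 0\<close> by (intro that[of "- x" "- x'"]) (auto simp: moebius_related_uminus_iff)
  qed
  have "form_period ?f = period (\<lambda>i. \<lfloor>complete_quotient y i\<rfloor>)"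
    unfolding form_period_def cf_elements_def x_def[symmetric] y(1) ..
  then show ?thesis
    using palindromic_odd_period_iff[OF y(3,2)] same
      supersymmetric_iff_moebius_related[OF f, folded x_def x'_def]
    by simp
qed

end
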